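(* Let $A$ be a finite-dimensional commutative $\mathbb{F}$-algebra over a field $\mathbb{F}$ and suppose that $\operatorname{Aut}(A)$ is finite. Then there exist a finite-dimensional evolution $\mathbb{F}$-algebra $\widetilde X$ and an algebra monomorphism $\widetilde\psi\colon A\longrightarrow\widetilde X$ such that every automorphism of $A$ lifts to an automorphism of $\widetilde X$. More precisely, there exists a group monomorphism $\operatorname{Aut}(A)\longrightarrow\operatorname{Aut}(\widetilde X)$, $\tau\longmapsto\widetilde g_\tau$, such that $\widetilde g_\tau\circ\widetilde\psi=\widetilde\psi\circ\tau$ for every $\tau\in\operatorname{Aut}(A)$.
   Context: An algebra over a field $\mathbb{F}$ is an $\mathbb{F}$-vector space with a bilinear multiplication, not assumed associative or unital. Algebra morphisms are linear multiplicative maps (not required to preserve a unit); $\operatorname{Aut}(A)$ is the group of $\mathbb{F}$-algebra automorphisms of $A$. An algebra $E$ over $\mathbb{F}$ is an evolution algebra if it admits a basis $\{e_i : i\in I\}$, called a natural basis, such that $e_ie_j=0$ whenever $i\neq j$. *)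

theory Defs
  imports "HOL-Algebra.Bij" "Jordan_Normal_Form.Missing_VectorSpace"
begin

text \<open>
  Algebras are carrier-based: the type of module records extends that of ring records, so such a
  record already has a slot for the product. Nothing is assumed about its component
  \<open>one\<close>, which is ignored throughout. The library locale \<open>algebra\<close> is not usable
  here, since it requires an associative, commutative and unital product.
\<close>

locale nonassoc_algebra = vectorspace K A for K and A (structure) +
  assumes prod_closed: "\<lbrakk>x \<in> carrier A; y \<in> carrier A\<rbrakk> \<Longrightarrow> x \<otimes> y \<in> carrier A"
    and prod_add_left: "\<lbrakk>x \<in> carrier A; y \<in> carrier A; z \<in> carrier A\<rbrakk>
      \<Longrightarrow> (x \<oplus> y) \<otimes> z = x \<otimes> z \<oplus> y \<otimes> z"
    and prod_add_right: "\<lbrakk>x \<in> carrier A; y \<in> carrier A; z \<in> carrier A\<rbrakk>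
      \<Longrightarrow> z \<otimes> (x \<oplus> y) = z \<otimes> x \<oplus> z \<otimes> y"
    and prod_smult_left: "\<lbrakk>c \<in> carrier K; x \<in> carrier A; y \<in> carrier A\<rbrakk>
      \<Longrightarrow> (c \<odot> x) \<otimes> y = c \<odot> (x \<otimes> y)"
    and prod_smult_right: "\<lbrakk>c \<in> carrier K; x \<in> carrier A; y \<in> carrier A\<rbrakk>
      \<Longrightarrow> x \<otimes> (c \<odot> y) = c \<odot> (x \<otimes> y)"

definition (in nonassoc_algebra) natural_basis :: "'c set \<Rightarrow> bool" where
  "natural_basis B \<longleftrightarrow> basis B \<and> (\<forall>e\<in>B. \<forall>e'\<in>B. e \<noteq> e' \<longrightarrow> e \<otimes> e' = \<zero>)"

locale evolution_algebra = nonassoc_algebra +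
  assumes ex_natural_basis: "\<exists>B. natural_basis B"

text \<open>\<open>hom A B\<close> only asks for multiplicativity; a unit need not be preserved.\<close>

definition algebra_hom ::
    "('k, 'r) ring_scheme \<Rightarrow> ('k, 'a, 'm) module_scheme \<Rightarrow> ('k, 'b, 'n) module_scheme \<Rightarrow> ('a \<Rightarrow> 'b) set"
  where "algebra_hom K A B = module_hom K A B \<inter> hom A B"

text \<open>
  As in \<open>AutoGroup\<close>, automorphisms are extensional functions (undefined outside the
  carrier), so that equality of automorphisms is equality of maps on the carrier.
\<close>

definition algebra_auto ::
    "('k, 'r) ring_scheme \<Rightarrow> ('k, 'a, 'm) module_scheme \<Rightarrow> ('a \<Rightarrow> 'a) set"
  where "algebra_auto K A = algebra_hom K A A \<inter> Bij (carrier A)"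

definition AlgebraAut ::
    "('k, 'r) ring_scheme \<Rightarrow> ('k, 'a, 'm) module_scheme \<Rightarrow> ('a \<Rightarrow> 'a) monoid"
  where "AlgebraAut K A = BijGroup (carrier A) \<lparr>carrier := algebra_auto K A\<rparr>"

lemma (in nonassoc_algebra) subgroup_algebra_auto:
  "subgroup (algebra_auto K A) (BijGroup (carrier A))"
proof (rule subgroup.intro)
  show "algebra_auto K A \<subseteq> carrier (BijGroup (carrier A))"
    by (auto simp: algebra_auto_def BijGroup_def)
next
  fix f g assume fg: "f \<in> algebra_auto K A" "g \<in> algebra_auto K A"
  then have "f \<in> Bij (carrier A)" "g \<in> Bij (carrier A)" by (auto simp: algebra_auto_def)
  moreover from this have "compose (carrier A) f g \<in> Bij (carrier A)" by (rule compose_Bij)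
  moreover have "compose (carrier A) f g \<in> algebra_hom K A A"
    using fg by (auto simp: algebra_auto_def algebra_hom_def module_hom_def hom_def compose_def
        Pi_def prod_closed)
  ultimately show "f \<otimes>\<^bsub>BijGroup (carrier A)\<^esub> g \<in> algebra_auto K A"
    by (simp add: BijGroup_def algebra_auto_def)
next
  show "\<one>\<^bsub>BijGroup (carrier A)\<^esub> \<in> algebra_auto K A"
    by (auto simp: BijGroup_def algebra_auto_def algebra_hom_def module_hom_def hom_def id_Bij
        prod_closed)
next
  fix f assume f: "f \<in> algebra_auto K A"
  define g where "g = (\<lambda>x\<in>carrier A. inv_into (carrier A) f x)"
  have B: "f \<in> Bij (carrier A)" and fh: "f \<in> algebra_hom K A A"
    using f by (auto simp: algebra_auto_def)
  have bij: "bij_betw f (carrier A) (carrier A)" using B by (simp add: Bij_def)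
  have f_add: "f (x \<oplus> y) = f x \<oplus> f y" if "x \<in> carrier A" "y \<in> carrier A" for x y
    using fh that unfolding algebra_hom_def module_hom_def by simp
  have f_smult: "f (c \<odot> x) = c \<odot> f x" if "c \<in> carrier K" "x \<in> carrier A" for c x
    using fh that unfolding algebra_hom_def module_hom_def by simp
  have f_mult: "f (x \<otimes> y) = f x \<otimes> f y" if "x \<in> carrier A" "y \<in> carrier A" for x y
    using fh that unfolding algebra_hom_def hom_def by simp
  have gB: "g \<in> Bij (carrier A)" unfolding g_def by (rule restrict_inv_into_Bij[OF B])
  have g_in: "g x \<in> carrier A" if "x \<in> carrier A" for x
    using that by (simp add: g_def Bij_inv_into_mem[OF B])
  have fg: "f (g x) = x" if "x \<in> carrier A" for x
    using that by (simp add: g_def bij_betw_inv_into_right[OF bij])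
  have g_eq: "g y = x" if "x \<in> carrier A" "y \<in> carrier A" "f x = y" for x y
    using that bij_betw_inv_into_left[OF bij that(1)] by (simp add: g_def)
  have add: "g (x \<oplus> y) = g x \<oplus> g y" if "x \<in> carrier A" "y \<in> carrier A" for x y
    by (rule g_eq) (simp_all add: that g_in f_add fg)
  have smult: "g (c \<odot> x) = c \<odot> g x" if "c \<in> carrier K" "x \<in> carrier A" for c x
    by (rule g_eq) (simp_all add: that g_in f_smult fg)
  have mult: "g (x \<otimes> y) = g x \<otimes> g y" if "x \<in> carrier A" "y \<in> carrier A" for x y
    by (rule g_eq) (simp_all add: that g_in f_mult fg prod_closed)
  have "g \<in> module_hom K A A"
    unfolding module_hom_def by (simp add: g_in add smult)
  moreover have "g \<in> hom A A"
    unfolding hom_def by (simp add: g_in mult)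
  ultimately have "g \<in> algebra_auto K A"
    using gB by (simp add: algebra_auto_def algebra_hom_def)
  then show "inv\<^bsub>BijGroup (carrier A)\<^esub> f \<in> algebra_auto K A"
    by (simp only: inv_BijGroup[OF B] g_def)
qed

lemma (in nonassoc_algebra) group_AlgebraAut: "group (AlgebraAut K A)"
  by (simp add: AlgebraAut_def subgroup.subgroup_is_group subgroup_algebra_auto group_BijGroup)

end

theory Submission
  imports Defs
begin

text \<open>
  A commutative product is a combination of squares of linear functionals,
  \<open>a b = \<Sum>\<^sub>i L\<^sub>i(a) L\<^sub>i(b) w\<^sub>i\<close>, and the \<open>L\<^sub>i\<close> may be taken to separate points. Then
  \<open>a \<mapsto> (L\<^sub>i(a))\<^sub>i\<close> embeds \<open>A\<close> into the evolution algebra with \<open>e\<^sub>i\<^sup>2 = \<Sum>\<^sub>j L\<^sub>j(w\<^sub>i) e\<^sub>j\<close>. To lift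
  the automorphisms, take one copy of this evolution algebra for every \<open>\<sigma> \<in> Aut A\<close>, with \<open>A\<close>
  mapped into the copy of \<open>\<sigma>\<close> by \<open>a \<mapsto> (L\<^sub>i(\<sigma> a))\<^sub>i\<close>; an automorphism then acts by permuting the
  copies. No averaging is involved, so the characteristic plays no role.
\<close>

section \<open>Evolution algebras from structure constants\<close>

text \<open>Coordinate model of the algebra with basis (e_i) in which e_i e_j = 0 for i distinct
  from j and e_i^2 is the sum of the \<open>c i k\<close> e_k. Vectors are extensional functions, so
  that two of them are equal as soon as they agree on \<open>J\<close>.\<close>

definition evol_alg :: "('k, 'r) ring_scheme \<Rightarrow> 'i set \<Rightarrow> ('i \<Rightarrow> 'i \<Rightarrow> 'k) \<Rightarrow> ('k, 'i \<Rightarrow> 'k) module" where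
  "evol_alg K J c =
    \<lparr>carrier = J \<rightarrow>\<^sub>E carrier K,
     mult = \<lambda>x y. \<lambda>k\<in>J. \<Oplus>\<^bsub>K\<^esub>i\<in>J. (x i \<otimes>\<^bsub>K\<^esub> y i) \<otimes>\<^bsub>K\<^esub> c i k,
     one = undefined,
     zero = \<lambda>k\<in>J. \<zero>\<^bsub>K\<^esub>,
     add = \<lambda>x y. \<lambda>k\<in>J. x k \<oplus>\<^bsub>K\<^esub> y k,
     smult = \<lambda>a x. \<lambda>k\<in>J. a \<otimes>\<^bsub>K\<^esub> x k\<rparr>"

locale structure_constants = field K for K (structure) +
  fixes J :: "'i set" and c :: "'i \<Rightarrow> 'i \<Rightarrow> 'a"
  assumes finite_J: "finite J"
    and c_closed: "\<lbrakk>i \<in> J; k \<in> J\<rbrakk> \<Longrightarrow> c i k \<in> carrier K"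
begin

abbreviation "E \<equiv> evol_alg K J c"

section \<open>Vector space and algebra axioms, checked coordinate by coordinate\<close>

lemma carrier_E: "carrier E = J \<rightarrow>\<^sub>E carrier K"
  by (simp add: evol_alg_def)

lemma E_closed [simp]: "x \<in> carrier E \<Longrightarrow> k \<in> J \<Longrightarrow> x k \<in> carrier K"
  by (auto simp: carrier_E)

lemma E_eqI:
  assumes "x \<in> carrier E" "y \<in> carrier E" "\<And>k. k \<in> J \<Longrightarrow> x k = y k"
  shows "x = y"
  using assms unfolding carrier_E by (rule PiE_ext)

lemma add_E [simp]: "k \<in> J \<Longrightarrow> (x \<oplus>\<^bsub>E\<^esub> y) k = x k \<oplus> y k"
  by (simp add: evol_alg_def)

lemma smult_E [simp]: "k \<in> J \<Longrightarrow> (a \<odot>\<^bsub>E\<^esub> x) k = a \<otimes> x k"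
  by (simp add: evol_alg_def)

lemma zero_E [simp]: "k \<in> J \<Longrightarrow> \<zero>\<^bsub>E\<^esub> k = \<zero>"
  by (simp add: evol_alg_def)

lemma mult_E: "k \<in> J \<Longrightarrow> (x \<otimes>\<^bsub>E\<^esub> y) k = (\<Oplus>i\<in>J. (x i \<otimes> y i) \<otimes> c i k)"
  by (simp add: evol_alg_def)

lemma zero_E_closed: "\<zero>\<^bsub>E\<^esub> \<in> carrier E"
  by (simp add: evol_alg_def)

lemma add_E_closed: "\<lbrakk>x \<in> carrier E; y \<in> carrier E\<rbrakk> \<Longrightarrow> x \<oplus>\<^bsub>E\<^esub> y \<in> carrier E"
  by (auto simp: evol_alg_def)

lemma smult_E_closed: "\<lbrakk>a \<in> carrier K; x \<in> carrier E\<rbrakk> \<Longrightarrow> a \<odot>\<^bsub>E\<^esub> x \<in> carrier E"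
  by (auto simp: evol_alg_def)

lemma mult_E_closed:
  assumes "x \<in> carrier E" "y \<in> carrier E"
  shows "x \<otimes>\<^bsub>E\<^esub> y \<in> carrier E"
proof -
  have "(\<Oplus>i\<in>J. (x i \<otimes> y i) \<otimes> c i k) \<in> carrier K" if "k \<in> J" for k
    using assms that by (intro finsum_closed) (auto simp: c_closed)
  then show ?thesis by (auto simp: evol_alg_def)
qed

lemma vectorspace_E: "vectorspace K E"
proof (rule vs_criteria)
  show "field K" by (rule field_axioms)
  show "\<forall>v\<in>carrier E. \<exists>neg_v\<in>carrier E. v \<oplus>\<^bsub>E\<^esub> neg_v = \<zero>\<^bsub>E\<^esub>"
  proof
    fix v assume v: "v \<in> carrier E"
    define u where "u = (\<lambda>k\<in>J. \<ominus> v k)"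
    have u: "u \<in> carrier E" using v by (auto simp: u_def carrier_E)
    have "v \<oplus>\<^bsub>E\<^esub> u = \<zero>\<^bsub>E\<^esub>"
      by (rule E_eqI) (use v u in \<open>simp_all add: zero_E_closed add_E_closed u_def r_neg\<close>)
    with u show "\<exists>neg_v\<in>carrier E. v \<oplus>\<^bsub>E\<^esub> neg_v = \<zero>\<^bsub>E\<^esub>" by blast
  qed
qed (auto simp: zero_E_closed add_E_closed smult_E_closed m_assoc a_ac l_distr r_distr
    intro!: E_eqI)

lemma nonassoc_algebra_E: "nonassoc_algebra K E"
proof (rule nonassoc_algebra.intro[OF vectorspace_E], unfold_locales)
  fix x y z assume xyz: "x \<in> carrier E" "y \<in> carrier E" "z \<in> carrier E"
  show "(x \<oplus>\<^bsub>E\<^esub> y) \<otimes>\<^bsub>E\<^esub> z = x \<otimes>\<^bsub>E\<^esub> z \<oplus>\<^bsub>E\<^esub> y \<otimes>\<^bsub>E\<^esub> z"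
  proof (rule E_eqI)
    fix k assume k: "k \<in> J"
    have "(\<Oplus>i\<in>J. ((x \<oplus>\<^bsub>E\<^esub> y) i \<otimes> z i) \<otimes> c i k)
        = (\<Oplus>i\<in>J. (x i \<otimes> z i) \<otimes> c i k \<oplus> (y i \<otimes> z i) \<otimes> c i k)"
      by (rule finsum_cong') (use xyz k in \<open>auto simp: c_closed l_distr\<close>)
    also have "\<dots> = (\<Oplus>i\<in>J. (x i \<otimes> z i) \<otimes> c i k) \<oplus> (\<Oplus>i\<in>J. (y i \<otimes> z i) \<otimes> c i k)"
      by (rule finsum_addf) (use xyz k in \<open>auto simp: c_closed\<close>)
    finally show "((x \<oplus>\<^bsub>E\<^esub> y) \<otimes>\<^bsub>E\<^esub> z) k = (x \<otimes>\<^bsub>E\<^esub> z \<oplus>\<^bsub>E\<^esub> y \<otimes>\<^bsub>E\<^esub> z) k"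
      using k by (simp add: mult_E)
  qed (use xyz in \<open>simp_all add: add_E_closed mult_E_closed\<close>)
  show "z \<otimes>\<^bsub>E\<^esub> (x \<oplus>\<^bsub>E\<^esub> y) = z \<otimes>\<^bsub>E\<^esub> x \<oplus>\<^bsub>E\<^esub> z \<otimes>\<^bsub>E\<^esub> y"
  proof (rule E_eqI)
    fix k assume k: "k \<in> J"
    have "(\<Oplus>i\<in>J. (z i \<otimes> (x \<oplus>\<^bsub>E\<^esub> y) i) \<otimes> c i k)
        = (\<Oplus>i\<in>J. (z i \<otimes> x i) \<otimes> c i k \<oplus> (z i \<otimes> y i) \<otimes> c i k)"
      by (rule finsum_cong') (use xyz k in \<open>auto simp: c_closed l_distr r_distr\<close>)
    also have "\<dots> = (\<Oplus>i\<in>J. (z i \<otimes> x i) \<otimes> c i k) \<oplus> (\<Oplus>i\<in>J. (z i \<otimes> y i) \<otimes> c i k)"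
      by (rule finsum_addf) (use xyz k in \<open>auto simp: c_closed\<close>)
    finally show "(z \<otimes>\<^bsub>E\<^esub> (x \<oplus>\<^bsub>E\<^esub> y)) k = (z \<otimes>\<^bsub>E\<^esub> x \<oplus>\<^bsub>E\<^esub> z \<otimes>\<^bsub>E\<^esub> y) k"
      using k by (simp add: mult_E)
  qed (use xyz in \<open>simp_all add: add_E_closed mult_E_closed\<close>)
next
  fix a x y assume axy: "a \<in> carrier K" "x \<in> carrier E" "y \<in> carrier E"
  \<comment> \<open>Both scalar laws are brought to this one form, in which the scalar is pulled out
    of the sum.\<close>
  have eq: "(\<Oplus>i\<in>J. (a \<otimes> (x i \<otimes> y i)) \<otimes> c i k) = a \<otimes> (\<Oplus>i\<in>J. (x i \<otimes> y i) \<otimes> c i k)"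
    if k: "k \<in> J" for k
  proof -
    have "a \<otimes> (\<Oplus>i\<in>J. (x i \<otimes> y i) \<otimes> c i k) = (\<Oplus>i\<in>J. a \<otimes> ((x i \<otimes> y i) \<otimes> c i k))"
      by (rule finsum_rdistr) (use axy k finite_J in \<open>auto simp: c_closed\<close>)
    also have "\<dots> = (\<Oplus>i\<in>J. (a \<otimes> (x i \<otimes> y i)) \<otimes> c i k)"
      by (rule finsum_cong') (use axy k in \<open>auto simp: c_closed m_assoc\<close>)
    finally show ?thesis ..
  qed
  show "(a \<odot>\<^bsub>E\<^esub> x) \<otimes>\<^bsub>E\<^esub> y = a \<odot>\<^bsub>E\<^esub> (x \<otimes>\<^bsub>E\<^esub> y)"
  proof (rule E_eqI)
    fix k assume k: "k \<in> J"
    have "(\<Oplus>i\<in>J. ((a \<odot>\<^bsub>E\<^esub> x) i \<otimes> y i) \<otimes> c i k) = (\<Oplus>i\<in>J. (a \<otimes> (x i \<otimes> y i)) \<otimes> c i k)"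
      by (rule finsum_cong') (use axy k in \<open>auto simp: c_closed m_assoc\<close>)
    with k show "((a \<odot>\<^bsub>E\<^esub> x) \<otimes>\<^bsub>E\<^esub> y) k = (a \<odot>\<^bsub>E\<^esub> (x \<otimes>\<^bsub>E\<^esub> y)) k"
      by (simp add: mult_E eq)
  qed (use axy in \<open>simp_all add: smult_E_closed mult_E_closed\<close>)
  show "x \<otimes>\<^bsub>E\<^esub> (a \<odot>\<^bsub>E\<^esub> y) = a \<odot>\<^bsub>E\<^esub> (x \<otimes>\<^bsub>E\<^esub> y)"
  proof (rule E_eqI)
    fix k assume k: "k \<in> J"
    have "(\<Oplus>i\<in>J. (x i \<otimes> (a \<odot>\<^bsub>E\<^esub> y) i) \<otimes> c i k) = (\<Oplus>i\<in>J. (a \<otimes> (x i \<otimes> y i)) \<otimes> c i k)"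
      by (rule finsum_cong') (use axy k in \<open>auto simp: c_closed m_lcomm\<close>)
    with k show "(x \<otimes>\<^bsub>E\<^esub> (a \<odot>\<^bsub>E\<^esub> y)) k = (a \<odot>\<^bsub>E\<^esub> (x \<otimes>\<^bsub>E\<^esub> y)) k"
      by (simp add: mult_E eq)
  qed (use axy in \<open>simp_all add: smult_E_closed mult_E_closed\<close>)
qed (rule mult_E_closed)

sublocale E: nonassoc_algebra K E
  by (rule nonassoc_algebra_E)

section \<open>The unit vectors as a natural basis\<close>

lemma finsum_E:
  assumes "f \<in> S \<rightarrow> carrier E" and "k \<in> J"
  shows "(\<Oplus>\<^bsub>E\<^esub>b\<in>S. f b) k = (\<Oplus>b\<in>S. f b k)"
  using assms(1)
\<comment> \<open>For infinite \<open>S\<close> both sums are zero by convention, so finiteness of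
  \<open>S\<close> need not be assumed.\<close>
proof (induction S rule: infinite_finite_induct)
  case (insert b S)
  then show ?case using \<open>k \<in> J\<close> by (simp add: Pi_iff)
qed (use \<open>k \<in> J\<close> in simp_all)

definition unit_vector :: "'i \<Rightarrow> 'i \<Rightarrow> 'a" where
  "unit_vector i = (\<lambda>k\<in>J. if k = i then \<one> else \<zero>)"

lemma unit_vector_closed [simp]: "unit_vector i \<in> carrier E"
  by (auto simp: unit_vector_def carrier_E)

text \<open>Compare the coordinates at i: they would be one and zero, which differ in a
  field.\<close>

lemma inj_unit_vector: "inj_on unit_vector J"
proof (rule inj_onI)
  fix i j assume ij: "i \<in> J" "j \<in> J" "unit_vector i = unit_vector j"
  have "unit_vector i i = unit_vector j i" using ij by simp
  then show "i = j" using ij by (simp add: unit_vector_def split: if_splits)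
qed

text \<open>After reindexing by \<open>J\<close>, only the index k contributes to the sum. This
  makes the coefficients of a linear combination readable from its coordinates, which gives both
  existence and uniqueness in \<open>basis_unit_vectors\<close>.\<close>

lemma lincomb_unit_vectors:
  assumes a: "a \<in> unit_vector ` J \<rightarrow> carrier K" and k: "k \<in> J"
  shows "E.lincomb a (unit_vector ` J) k = a (unit_vector k)"
proof -
  have aK: "a (unit_vector i) \<in> carrier K" if "i \<in> J" for i
    using a that by auto
  have "E.lincomb a (unit_vector ` J) k = (\<Oplus>b\<in>unit_vector ` J. (a b \<odot>\<^bsub>E\<^esub> b) k)"
    unfolding E.lincomb_def
    by (rule finsum_E) (use aK k in \<open>auto intro: smult_E_closed\<close>)
  also have "\<dots> = (\<Oplus>i\<in>J. (a (unit_vector i) \<odot>\<^bsub>E\<^esub> unit_vector i) k)"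
    by (rule finsum_reindex) (use aK k in \<open>auto simp: inj_unit_vector\<close>)
  also have "\<dots> = (\<Oplus>i\<in>J. if k = i then a (unit_vector i) else \<zero>)"
    by (rule finsum_cong') (use aK k in \<open>simp_all add: unit_vector_def\<close>)
  also have "\<dots> = a (unit_vector k)"
    by (rule finsum_singleton) (use aK k finite_J in simp_all)
  finally show ?thesis .
qed

lemma basis_unit_vectors: "E.basis (unit_vector ` J)"
proof -
  let ?B = "unit_vector ` J"
  have "\<exists>!a. a \<in> ?B \<rightarrow>\<^sub>E carrier K \<and> E.lincomb a ?B = v" if v: "v \<in> carrier E" for v
  proof (rule ex1I)
    \<comment> \<open>Coefficient functions are defined on basis vectors, not on indices; the
      inverse of \<open>unit_vector\<close> recovers the index.\<close>
    let ?a = "\<lambda>b\<in>?B. v (inv_into J unit_vector b)"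
    have a: "?a \<in> ?B \<rightarrow>\<^sub>E carrier K"
      using v by (auto simp: inv_into_f_f[OF inj_unit_vector])
    moreover have "E.lincomb ?a ?B = v"
    proof (rule E_eqI[OF _ v])
      show "E.lincomb ?a ?B \<in> carrier E"
        using a by (intro E.lincomb_closed) (auto simp: PiE_def)
      fix k assume k: "k \<in> J"
      have "E.lincomb ?a ?B k = ?a (unit_vector k)"
        by (rule lincomb_unit_vectors) (use a k in \<open>auto simp: PiE_def\<close>)
      then show "E.lincomb ?a ?B k = v k"
        using k by (simp add: inv_into_f_f[OF inj_unit_vector])
    qed
    ultimately show "?a \<in> ?B \<rightarrow>\<^sub>E carrier K \<and> E.lincomb ?a ?B = v" ..
    fix b assume b: "b \<in> ?B \<rightarrow>\<^sub>E carrier K \<and> E.lincomb b ?B = v"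
    show "b = ?a"
    proof (rule PiE_ext)
      fix e assume "e \<in> ?B"
      then obtain k where k: "k \<in> J" "e = unit_vector k" by blast
      then have "v k = b e"
        using lincomb_unit_vectors[of b k] b by (auto simp: PiE_def)
      then show "b e = ?a e"
        using k by (simp add: inv_into_f_f[OF inj_unit_vector])
    qed (use b a in auto)
  qed
  moreover have "?B \<subseteq> carrier E" "finite ?B" using finite_J by auto
  ultimately show ?thesis using E.basis_criterion[of ?B] by blast
qed

lemma natural_basis_unit_vectors: "E.natural_basis (unit_vector ` J)"
  unfolding E.natural_basis_def
proof (intro conjI ballI impI basis_unit_vectors)
  fix e e' assume "e \<in> unit_vector ` J" "e' \<in> unit_vector ` J" "e \<noteq> e'"
  then obtain i j where ij: "i \<in> J" "j \<in> J" "i \<noteq> j" "e = unit_vector i" "e' = unit_vector j"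
    by blast
  show "e \<otimes>\<^bsub>E\<^esub> e' = \<zero>\<^bsub>E\<^esub>"
  proof (rule E_eqI)
    fix k assume k: "k \<in> J"
    \<comment> \<open>Every summand vanishes: l cannot equal both i and j, so one of the two unit
      vectors is zero at l.\<close>
    have "(\<Oplus>l\<in>J. (e l \<otimes> e' l) \<otimes> c l k) = \<zero>"
      by (rule add.finprod_one_eqI) (use ij k in \<open>auto simp: unit_vector_def c_closed\<close>)
    with k show "(e \<otimes>\<^bsub>E\<^esub> e') k = \<zero>\<^bsub>E\<^esub> k" by (simp add: mult_E)
  qed (use ij in \<open>auto intro: mult_E_closed\<close>)
qed

lemma evolution_algebra_E: "evolution_algebra K E"
  by unfold_locales (use natural_basis_unit_vectors in blast)

lemma fin_dim_E: "E.fin_dim"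
  using basis_unit_vectors finite_J unfolding E.fin_dim_def E.basis_def by blast

text \<open>Precomposition reverses composition: \<open>permute \<sigma>\<close> after
  \<open>permute \<tau>\<close> is the permutation by \<tau> after \<sigma>. The restriction to the
  carrier supplies the extensionality demanded by \<open>Bij\<close>.\<close>

definition permute :: "('i \<Rightarrow> 'i) \<Rightarrow> ('i \<Rightarrow> 'a) \<Rightarrow> 'i \<Rightarrow> 'a" where
  "permute \<sigma> = (\<lambda>x\<in>carrier E. \<lambda>i\<in>J. x (\<sigma> i))"

lemma permute_apply [simp]: "x \<in> carrier E \<Longrightarrow> i \<in> J \<Longrightarrow> permute \<sigma> x i = x (\<sigma> i)"
  by (simp add: permute_def)

lemma permute_closed: "\<sigma> \<in> J \<rightarrow> J \<Longrightarrow> x \<in> carrier E \<Longrightarrow> permute \<sigma> x \<in> carrier E"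
  by (auto simp: permute_def carrier_E)

text \<open>The product at \<sigma>(k) is a sum over \<open>J\<close>. Substituting \<sigma>(i) for
  i and using the invariance of the structure constants turns it into the product of the permuted
  vectors at k. The inverse permutation gives the inverse map.\<close>

lemma permute_algebra_auto:
  assumes \<sigma>: "bij_betw \<sigma> J J" and c: "\<And>i k. \<lbrakk>i \<in> J; k \<in> J\<rbrakk> \<Longrightarrow> c (\<sigma> i) (\<sigma> k) = c i k"
  shows "permute \<sigma> \<in> algebra_auto K E"
proof -
  have \<sigma>J: "\<sigma> \<in> J \<rightarrow> J" using \<sigma> by (rule bij_betw_imp_funcset)
  have \<sigma>i: "\<sigma> i \<in> J" if "i \<in> J" for i using that \<sigma>J by auto
  note cl = permute_closed[OF \<sigma>J]
  have "permute \<sigma> \<in> module_hom K E E"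
    unfolding module_hom_def
    by (auto intro!: E_eqI simp: cl \<sigma>i)
  moreover have "permute \<sigma> \<in> hom E E"
    unfolding hom_def
  proof (clarsimp simp: cl, rule E_eqI)
    fix x y k assume xyk: "x \<in> carrier E" "y \<in> carrier E" "k \<in> J"
    have "(\<Oplus>i\<in>J. (x i \<otimes> y i) \<otimes> c i (\<sigma> k)) = (\<Oplus>i\<in>\<sigma> ` J. (x i \<otimes> y i) \<otimes> c i (\<sigma> k))"
      using \<sigma> by (simp add: bij_betw_def)
    also have "\<dots> = (\<Oplus>i\<in>J. (x (\<sigma> i) \<otimes> y (\<sigma> i)) \<otimes> c (\<sigma> i) (\<sigma> k))"
      by (rule finsum_reindex) (use \<sigma> xyk \<sigma>i in \<open>auto simp: bij_betw_def c_closed\<close>)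
    also have "\<dots> = (\<Oplus>i\<in>J. (permute \<sigma> x i \<otimes> permute \<sigma> y i) \<otimes> c i k)"
      by (rule finsum_cong') (use xyk in \<open>auto simp: c \<sigma>i c_closed\<close>)
    finally show "permute \<sigma> (x \<otimes>\<^bsub>E\<^esub> y) k = (permute \<sigma> x \<otimes>\<^bsub>E\<^esub> permute \<sigma> y) k"
      using xyk by (simp add: mult_E mult_E_closed \<sigma>i)
  qed (simp_all add: cl mult_E_closed)
  moreover have "permute \<sigma> \<in> Bij (carrier E)"
  proof -
    let ?\<tau> = "inv_into J \<sigma>"
    have \<tau>: "bij_betw ?\<tau> J J" using \<sigma> by (rule bij_betw_inv_into)
    then have \<tau>J: "?\<tau> \<in> J \<rightarrow> J" by (rule bij_betw_imp_funcset)
    have \<tau>i: "?\<tau> i \<in> J" if "i \<in> J" for i using that \<tau>J by auto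
    have "bij_betw (permute \<sigma>) (carrier E) (carrier E)"
    proof (rule bij_betw_byWitness[where f' = "permute ?\<tau>"])
      show "\<forall>x\<in>carrier E. permute ?\<tau> (permute \<sigma> x) = x"
        by (auto intro!: E_eqI simp: cl permute_closed[OF \<tau>J] \<tau>i bij_betw_inv_into_right[OF \<sigma>])
      show "\<forall>x\<in>carrier E. permute \<sigma> (permute ?\<tau> x) = x"
        by (auto intro!: E_eqI simp: cl permute_closed[OF \<tau>J] \<sigma>i bij_betw_inv_into_left[OF \<sigma>])
    qed (auto simp: cl permute_closed[OF \<tau>J])
    then show ?thesis by (simp add: Bij_def permute_def)
  qed
  ultimately show ?thesis by (simp add: algebra_auto_def algebra_hom_def)
qed

end

section \<open>Commutative products as sums of squares of functionals\<close>

context nonassoc_algebra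
begin

section \<open>Linear functionals and coordinates relative to a basis\<close>

definition linear_functional :: "('c \<Rightarrow> 'a) \<Rightarrow> bool" where
  "linear_functional f \<longleftrightarrow> f \<in> carrier A \<rightarrow> carrier K
    \<and> (\<forall>x\<in>carrier A. \<forall>y\<in>carrier A. f (x \<oplus> y) = f x \<oplus>\<^bsub>K\<^esub> f y)
    \<and> (\<forall>r\<in>carrier K. \<forall>x\<in>carrier A. f (r \<odot> x) = r \<otimes>\<^bsub>K\<^esub> f x)"

lemma linear_functionalD:
  assumes "linear_functional f"
  shows linear_functional_closed: "x \<in> carrier A \<Longrightarrow> f x \<in> carrier K"
    and linear_functional_add: "\<lbrakk>x \<in> carrier A; y \<in> carrier A\<rbrakk> \<Longrightarrow> f (x \<oplus> y) = f x \<oplus>\<^bsub>K\<^esub> f y"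
    and linear_functional_smult: "\<lbrakk>r \<in> carrier K; x \<in> carrier A\<rbrakk> \<Longrightarrow> f (r \<odot> x) = r \<otimes>\<^bsub>K\<^esub> f x"
  using assms by (auto simp: linear_functional_def)

lemma linear_functional_plus:
  assumes "linear_functional f" "linear_functional g"
  shows "linear_functional (\<lambda>x. f x \<oplus>\<^bsub>K\<^esub> g x)"
  using assms linear_functionalD[OF assms(1)] linear_functionalD[OF assms(2)]
  unfolding linear_functional_def
  by (auto simp: R.r_distr R.a_ac)

lemma linear_functional_finsum:
  assumes f: "linear_functional f" and g: "g \<in> S \<rightarrow> carrier A" and S: "finite S"
  shows "f (\<Oplus>i\<in>S. g i) = (\<Oplus>\<^bsub>K\<^esub>i\<in>S. f (g i))"
  using S g
proof (induction S rule: finite_induct)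
  case empty
  have "f \<zero> = f (\<zero>\<^bsub>K\<^esub> \<odot> \<zero>)" by simp
  also have "\<dots> = \<zero>\<^bsub>K\<^esub>"
    by (subst linear_functional_smult[OF f]) (simp_all add: linear_functional_closed[OF f])
  finally show ?case by simp
next
  case (insert i S)
  then show ?case
    using linear_functionalD[OF f] by (simp add: Pi_iff)
qed

text \<open>Coordinates are linear because they are unique: the sum of the coefficient functions of
  a and b represents a + b, hence is the coefficient function of a + b. Scalar multiples are treated
  alike.\<close>

lemma coordinate_functionals_exist:
  assumes "fin_dim"
  obtains B x where "finite B" "B \<subseteq> carrier A" "\<And>u. u \<in> B \<Longrightarrow> linear_functional (x u)"
    "\<And>a. a \<in> carrier A \<Longrightarrow> a = (\<Oplus>u\<in>B. x u a \<odot> u)"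
proof -
  obtain B where B: "finite B" "basis B"
    using finite_basis_exists[OF assms] by blast
  then have BA: "B \<subseteq> carrier A" by (simp add: basis_def)
  have ex: "\<exists>!f. f \<in> B \<rightarrow>\<^sub>E carrier K \<and> lincomb f B = a" if "a \<in> carrier A" for a
    using basis_criterion[OF B(1) BA] B(2) that by blast
  define F where "F a = (THE f. f \<in> B \<rightarrow>\<^sub>E carrier K \<and> lincomb f B = a)" for a
  have F: "F a \<in> B \<rightarrow>\<^sub>E carrier K" "lincomb (F a) B = a" if "a \<in> carrier A" for a
    using theI'[OF ex[OF that]] by (simp_all add: F_def)
  have F_eq: "F a = f" if "a \<in> carrier A" "f \<in> B \<rightarrow>\<^sub>E carrier K" "lincomb f B = a" for f a
    using ex F that by blast
  have FK: "F a u \<in> carrier K" if "a \<in> carrier A" "u \<in> B" for a u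
    using F(1)[OF that(1)] that(2) by auto
  \<comment> \<open>Linearity of \<open>lincomb\<close> in the coefficient function is what shows
    that sums and multiples of coefficient functions represent the right vectors.\<close>
  interpret L: mod_hom K "R.func_space B" A "\<lambda>f. lincomb f B"
    by (rule lincomb_is_mod_hom[OF B(1) BA])
  have carr: "carrier (R.func_space B) = B \<rightarrow>\<^sub>E carrier K"
    by (simp add: R.func_space_def)
  show thesis
  proof
    show "linear_functional (\<lambda>a. F a u)" if u: "u \<in> B" for u
      unfolding linear_functional_def
    proof (intro conjI ballI)
      fix a b assume ab: "a \<in> carrier A" "b \<in> carrier A"
      have "F (a \<oplus> b) = F a \<oplus>\<^bsub>R.func_space B\<^esub> F b"
      proof (rule F_eq)
        show "F a \<oplus>\<^bsub>R.func_space B\<^esub> F b \<in> B \<rightarrow>\<^sub>E carrier K"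
          using L.M.M.a_closed[of "F a" "F b"] F[OF ab(1)] F[OF ab(2)] by (simp add: carr)
        show "lincomb (F a \<oplus>\<^bsub>R.func_space B\<^esub> F b) B = a \<oplus> b"
          using F[OF ab(1)] F[OF ab(2)] by (simp add: carr)
      qed (use ab in simp)
      then show "F (a \<oplus> b) u = F a u \<oplus>\<^bsub>K\<^esub> F b u"
        using u by (simp add: R.func_space_def)
    next
      fix r a assume ra: "r \<in> carrier K" "a \<in> carrier A"
      have "F (r \<odot> a) = r \<odot>\<^bsub>R.func_space B\<^esub> F a"
      proof (rule F_eq)
        show "r \<odot>\<^bsub>R.func_space B\<^esub> F a \<in> B \<rightarrow>\<^sub>E carrier K"
          using L.M.smult_closed[of r "F a"] F[OF ra(2)] ra by (simp add: carr)
        show "lincomb (r \<odot>\<^bsub>R.func_space B\<^esub> F a) B = r \<odot> a"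
          using F[OF ra(2)] ra by (simp add: carr)
      qed (use ra in simp)
      then show "F (r \<odot> a) u = r \<otimes>\<^bsub>K\<^esub> F a u"
        using u by (simp add: R.func_space_def)
    qed (use FK u in auto)
    show "a = (\<Oplus>u\<in>B. F a u \<odot> u)" if "a \<in> carrier A" for a
      using F(2)[OF that] by (simp add: lincomb_def)
  qed (use B BA in auto)
qed

text \<open>The set \<open>F\<close> records functionals that are forced to occur in the decomposition; these will
  have to separate the points of \<open>A\<close>.\<close>

definition diagonalizable :: "('c \<Rightarrow> 'a) set \<Rightarrow> ('c \<Rightarrow> 'c \<Rightarrow> 'c) \<Rightarrow> bool" where
  "diagonalizable F \<beta> \<longleftrightarrow> (\<exists>n L w. (\<forall>i<n. linear_functional (L i) \<and> w i \<in> carrier A)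
    \<and> F \<subseteq> L ` {..<n::nat}
    \<and> (\<forall>a\<in>carrier A. \<forall>b\<in>carrier A. \<beta> a b = (\<Oplus>i\<in>{..<n}. (L i a \<otimes>\<^bsub>K\<^esub> L i b) \<odot> w i)))"

section \<open>Closure properties of combinations of squares\<close>

lemma diagonalizable_zero: "diagonalizable {} (\<lambda>a b. \<zero>)"
  unfolding diagonalizable_def by (rule exI[of _ 0]) simp

lemma diagonalizable_square:
  assumes "linear_functional f" "w \<in> carrier A"
  shows "diagonalizable {f} (\<lambda>a b. (f a \<otimes>\<^bsub>K\<^esub> f b) \<odot> w)"
  unfolding diagonalizable_def
  by (rule exI[of _ 1], rule exI[of _ "\<lambda>_. f"], rule exI[of _ "\<lambda>_. w"])
    (use assms linear_functionalD[OF assms(1)] in \<open>auto simp: lessThan_Suc\<close>)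

text \<open>Shrinking the forced set allows the functionals introduced by polarisation to be
  forgotten, so that only those wanted for separating points are tracked.\<close>

lemma diagonalizable_cong:
  assumes "diagonalizable F \<beta>" and "G \<subseteq> F"
    and "\<And>a b. \<lbrakk>a \<in> carrier A; b \<in> carrier A\<rbrakk> \<Longrightarrow> \<gamma> a b = \<beta> a b"
  shows "diagonalizable G \<gamma>"
proof -
  obtain n L w where "\<forall>i<n. linear_functional (L i) \<and> w i \<in> carrier A" "F \<subseteq> L ` {..<n::nat}"
      "\<forall>a\<in>carrier A. \<forall>b\<in>carrier A. \<beta> a b = (\<Oplus>i\<in>{..<n}. (L i a \<otimes>\<^bsub>K\<^esub> L i b) \<odot> w i)"
    using assms(1) unfolding diagonalizable_def by blast
  then show ?thesis unfolding diagonalizable_def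
    by (intro exI[of _ n] exI[of _ L] exI[of _ w]) (use assms(2,3) in auto)
qed

text \<open>The two families are concatenated, the second one shifted by \<open>n\<close>; the sum
  then splits into the two blocks.\<close>

lemma diagonalizable_plus:
  assumes "diagonalizable F \<beta>" "diagonalizable G \<gamma>"
  shows "diagonalizable (F \<union> G) (\<lambda>a b. \<beta> a b \<oplus> \<gamma> a b)"
proof -
  obtain n L w where 1: "\<And>i. i < n \<Longrightarrow> linear_functional (L i)" "\<And>i. i < n \<Longrightarrow> w i \<in> carrier A"
      "F \<subseteq> L ` {..<n::nat}"
      "\<And>a b. \<lbrakk>a \<in> carrier A; b \<in> carrier A\<rbrakk> \<Longrightarrow> \<beta> a b = (\<Oplus>i\<in>{..<n}. (L i a \<otimes>\<^bsub>K\<^esub> L i b) \<odot> w i)"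
    using assms(1) unfolding diagonalizable_def by blast
  obtain m M v where 2: "\<And>i. i < m \<Longrightarrow> linear_functional (M i)" "\<And>i. i < m \<Longrightarrow> v i \<in> carrier A"
      "G \<subseteq> M ` {..<m::nat}"
      "\<And>a b. \<lbrakk>a \<in> carrier A; b \<in> carrier A\<rbrakk> \<Longrightarrow> \<gamma> a b = (\<Oplus>i\<in>{..<m}. (M i a \<otimes>\<^bsub>K\<^esub> M i b) \<odot> v i)"
    using assms(2) unfolding diagonalizable_def by blast
  define N where "N i = (if i < n then L i else M (i - n))" for i
  define u where "u i = (if i < n then w i else v (i - n))" for i
  have split: "{..<n + m} = {..<n} \<union> (+) n ` {..<m}"
  proof (intro equalityI subsetI)
    fix i assume i: "i \<in> {..<n + m}"
    show "i \<in> {..<n} \<union> (+) n ` {..<m}"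
    proof (cases "i < n")
      case False
      then have "i = n + (i - n)" "i - n < m" using i by auto
      then show ?thesis by blast
    qed simp
  qed auto
  have N1: "N i = L i" "u i = w i" if "i < n" for i using that by (simp_all add: N_def u_def)
  have N2: "N (n + i) = M i" "u (n + i) = v i" for i by (simp_all add: N_def u_def)
  have lin: "linear_functional (N i) \<and> u i \<in> carrier A" if "i < n + m" for i
    using that 1(1,2) 2(1,2) by (auto simp: N_def u_def)
  moreover have "F \<union> G \<subseteq> N ` {..<n + m}"
  proof -
    have "N ` {..<n + m} = L ` {..<n} \<union> M ` {..<m}"
      unfolding split image_Un image_image using N1 N2 by auto
    then show ?thesis using 1(3) 2(3) by auto
  qed
  moreover have "\<beta> a b \<oplus> \<gamma> a b = (\<Oplus>i\<in>{..<n + m}. (N i a \<otimes>\<^bsub>K\<^esub> N i b) \<odot> u i)"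
    if ab: "a \<in> carrier A" "b \<in> carrier A" for a b
  proof -
    let ?h = "\<lambda>i. (N i a \<otimes>\<^bsub>K\<^esub> N i b) \<odot> u i"
    have h: "?h i \<in> carrier A" if "i < n + m" for i
      using lin[OF that] linear_functional_closed ab by simp
    have "(\<Oplus>i\<in>{..<n + m}. ?h i) = (\<Oplus>i\<in>{..<n}. ?h i) \<oplus> (\<Oplus>i\<in>(+) n ` {..<m}. ?h i)"
      unfolding split by (rule M.finsum_Un_disjoint) (use h in auto)
    also have "(\<Oplus>i\<in>(+) n ` {..<m}. ?h i) = (\<Oplus>i\<in>{..<m}. ?h (n + i))"
      by (rule M.finsum_reindex) (use h in auto)
    also have "\<dots> = \<gamma> a b" by (simp add: N2 2(4)[OF ab])
    also have "(\<Oplus>i\<in>{..<n}. ?h i) = \<beta> a b"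
      unfolding 1(4)[OF ab] by (rule M.finsum_cong') (use h N1 in \<open>force simp flip: N1\<close>)+
    finally show ?thesis ..
  qed
  ultimately show ?thesis unfolding diagonalizable_def by blast
qed

text \<open>Polarisation; only integer coefficients occur, so this is valid in characteristic two.\<close>

lemma diagonalizable_cross:
  assumes f: "linear_functional f" and g: "linear_functional g" and w: "w \<in> carrier A"
  shows "diagonalizable {} (\<lambda>a b. (f a \<otimes>\<^bsub>K\<^esub> g b \<oplus>\<^bsub>K\<^esub> f b \<otimes>\<^bsub>K\<^esub> g a) \<odot> w)"
proof -
  define v where "v = (\<ominus>\<^bsub>K\<^esub> \<one>\<^bsub>K\<^esub>) \<odot> w"
  have v: "v \<in> carrier A" using w by (simp add: v_def)
  \<comment> \<open>Symbolically (f + g)(f + g) - f f - g g. The signs are absorbed into the vector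
    \<open>v\<close>, which leaves three squares of functionals.\<close>
  note diag = diagonalizable_plus[OF diagonalizable_square[OF linear_functional_plus[OF f g] w]
      diagonalizable_plus[OF diagonalizable_square[OF f v] diagonalizable_square[OF g v]]]
  show ?thesis
  proof (rule diagonalizable_cong[OF diag])
    fix a b assume ab: "a \<in> carrier A" "b \<in> carrier A"
    let ?s = "(f a \<oplus>\<^bsub>K\<^esub> g a) \<otimes>\<^bsub>K\<^esub> (f b \<oplus>\<^bsub>K\<^esub> g b)"
    note cl [simp] = linear_functional_closed[OF f ab(1)] linear_functional_closed[OF f ab(2)]
      linear_functional_closed[OF g ab(1)] linear_functional_closed[OF g ab(2)]
    have "?s \<odot> w \<oplus> ((f a \<otimes>\<^bsub>K\<^esub> f b) \<odot> v \<oplus> (g a \<otimes>\<^bsub>K\<^esub> g b) \<odot> v)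
      = (?s \<oplus>\<^bsub>K\<^esub> (f a \<otimes>\<^bsub>K\<^esub> f b \<otimes>\<^bsub>K\<^esub> (\<ominus>\<^bsub>K\<^esub> \<one>\<^bsub>K\<^esub>) \<oplus>\<^bsub>K\<^esub> g a \<otimes>\<^bsub>K\<^esub> g b \<otimes>\<^bsub>K\<^esub> (\<ominus>\<^bsub>K\<^esub> \<one>\<^bsub>K\<^esub>))) \<odot> w"
      using w by (simp add: v_def smult_l_distr smult_assoc1)
    also have "?s \<oplus>\<^bsub>K\<^esub> (f a \<otimes>\<^bsub>K\<^esub> f b \<otimes>\<^bsub>K\<^esub> (\<ominus>\<^bsub>K\<^esub> \<one>\<^bsub>K\<^esub>) \<oplus>\<^bsub>K\<^esub> g a \<otimes>\<^bsub>K\<^esub> g b \<otimes>\<^bsub>K\<^esub> (\<ominus>\<^bsub>K\<^esub> \<one>\<^bsub>K\<^esub>))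
        = f a \<otimes>\<^bsub>K\<^esub> g b \<oplus>\<^bsub>K\<^esub> f b \<otimes>\<^bsub>K\<^esub> g a"
      using cl by algebra
    finally show "(f a \<otimes>\<^bsub>K\<^esub> g b \<oplus>\<^bsub>K\<^esub> f b \<otimes>\<^bsub>K\<^esub> g a) \<odot> w
      = ?s \<odot> w \<oplus> ((f a \<otimes>\<^bsub>K\<^esub> f b) \<odot> v \<oplus> (g a \<otimes>\<^bsub>K\<^esub> g b) \<odot> v)" ..
  qed simp
qed

section \<open>Diagonal form of a commutative product\<close>

lemma zero_mult [simp]: "x \<in> carrier A \<Longrightarrow> \<zero> \<otimes> x = \<zero>"
  using prod_smult_left[of "\<zero>\<^bsub>K\<^esub>" "\<zero>" x] prod_closed[of \<zero> x] by simp

lemma mult_zero [simp]: "x \<in> carrier A \<Longrightarrow> x \<otimes> \<zero> = \<zero>"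
  using prod_smult_right[of "\<zero>\<^bsub>K\<^esub>" x "\<zero>"] prod_closed[of x \<zero>] by simp

text \<open>Expand both factors in a basis. The terms with u^2 are squares of coordinate
  functionals; the mixed terms for u and v pair up, by commutativity, into a symmetric expression
  times u v, which polarisation handles. The square terms force all coordinate functionals to occur,
  and these separate points.\<close>

lemma diagonalizable_product:
  assumes "fin_dim" and comm: "\<forall>x\<in>carrier A. \<forall>y\<in>carrier A. x \<otimes> y = y \<otimes> x"
  obtains F where "diagonalizable F (\<lambda>a b. a \<otimes> b)"
    and "\<And>a b. \<lbrakk>a \<in> carrier A; b \<in> carrier A; \<forall>f\<in>F. f a = f b\<rbrakk> \<Longrightarrow> a = b"
proof -
  obtain B x where B: "finite B" "B \<subseteq> carrier A" and x: "\<And>u. u \<in> B \<Longrightarrow> linear_functional (x u)"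
    and expand: "\<And>a. a \<in> carrier A \<Longrightarrow> a = (\<Oplus>u\<in>B. x u a \<odot> u)"
    using coordinate_functionals_exist[OF assms(1)] by blast
  \<comment> \<open>The component of a along \<open>S\<close>. Induction on \<open>S\<close>
    replaces a double sum over the basis; for \<open>S\<close> equal to \<open>B\<close> the
    component is a itself.\<close>
  define s where "s S a = (\<Oplus>u\<in>S. x u a \<odot> u)" for S a
  have xK: "x u a \<in> carrier K" if "u \<in> B" "a \<in> carrier A" for u a
    using linear_functional_closed[OF x] that by simp
  have BA: "u \<in> carrier A" if "u \<in> B" for u using that B(2) by auto
  have sA: "s S a \<in> carrier A" if "S \<subseteq> B" "a \<in> carrier A" for S a
    unfolding s_def by (rule M.finsum_closed) (use that xK BA in auto)
  have s_empty: "s {} a = \<zero>" for a by (simp add: s_def)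
  have s_insert: "s (insert u S) a = x u a \<odot> u \<oplus> s S a"
    if "u \<in> B" "S \<subseteq> B" "finite S" "u \<notin> S" "a \<in> carrier A" for u S a
    unfolding s_def by (rule M.finsum_insert) (use that xK BA in auto)
  \<comment> \<open>The symmetrised mixed terms of one vector \<open>z\<close>, with coefficient
    functional \<open>f\<close>, against all of \<open>S\<close>. Each new basis vector adds one
    polarised pair.\<close>
  have cross: "diagonalizable {} (\<lambda>a b. f a \<odot> (z \<otimes> s S b) \<oplus> f b \<odot> (z \<otimes> s S a))"
    if f: "linear_functional f" and z: "z \<in> carrier A" and S: "finite S" "S \<subseteq> B" for f z S
    using S
  proof (induction S rule: finite_induct)
    case empty
    show ?case
      by (rule diagonalizable_cong[OF diagonalizable_zero])
        (use z linear_functional_closed[OF f] in \<open>simp_all add: s_empty\<close>)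
  next
    case (insert u S)
    then have u: "u \<in> B" and S: "S \<subseteq> B" by auto
    note diag = diagonalizable_plus[OF
        diagonalizable_cross[OF f x[OF u] prod_closed[OF z BA[OF u]]] insert.IH[OF S]]
    show ?case
    proof (rule diagonalizable_cong[OF diag])
      fix a b assume ab: "a \<in> carrier A" "b \<in> carrier A"
      have expand_term: "f c \<odot> (z \<otimes> s (insert u S) d)
          = (f c \<otimes>\<^bsub>K\<^esub> x u d) \<odot> (z \<otimes> u) \<oplus> f c \<odot> (z \<otimes> s S d)"
        if "c \<in> carrier A" "d \<in> carrier A" for c d
        using that z u S insert.hyps
        by (simp add: s_insert BA xK sA prod_add_right prod_smult_right smult_r_distr smult_assoc1
            prod_closed linear_functional_closed[OF f])
      have cl: "f c \<odot> (z \<otimes> s S d) \<in> carrier A" "f c \<otimes>\<^bsub>K\<^esub> x u d \<in> carrier K"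
        if "c \<in> carrier A" "d \<in> carrier A" for c d
        using that z u S by (simp_all add: BA xK sA prod_closed linear_functional_closed[OF f])
      show "f a \<odot> (z \<otimes> s (insert u S) b) \<oplus> f b \<odot> (z \<otimes> s (insert u S) a)
        = (f a \<otimes>\<^bsub>K\<^esub> x u b \<oplus>\<^bsub>K\<^esub> f b \<otimes>\<^bsub>K\<^esub> x u a) \<odot> (z \<otimes> u)
          \<oplus> (f a \<odot> (z \<otimes> s S b) \<oplus> f b \<odot> (z \<otimes> s S a))"
        using ab z u
        by (simp add: expand_term cl smult_l_distr prod_closed BA M.a_ac)
    qed simp
  qed
  have "diagonalizable (x ` S) (\<lambda>a b. s S a \<otimes> s S b)" if "finite S" "S \<subseteq> B" for S
    using that
  proof (induction S rule: finite_induct)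
    case empty
    show ?case
      by (rule diagonalizable_cong[OF diagonalizable_zero]) (simp_all add: s_empty)
  next
    case (insert u S)
    then have u: "u \<in> B" and S: "S \<subseteq> B" by auto
    \<comment> \<open>Multiplying out (x_u(a) u + s_S(a)) (x_u(b) u + s_S(b)) gives a square, the
      mixed terms of u against \<open>S\<close>, and the product from the induction
      hypothesis.\<close>
    note diag = diagonalizable_plus[OF diagonalizable_square[OF x[OF u] prod_closed[OF BA[OF u] BA[OF u]]]
        diagonalizable_plus[OF cross[OF x[OF u] BA[OF u] insert.hyps(1) S] insert.IH[OF S]]]
    show ?case
    proof (rule diagonalizable_cong[OF diag])
      fix a b assume ab: "a \<in> carrier A" "b \<in> carrier A"
      \<comment> \<open>Here commutativity enters: it makes the mixed terms symmetric in a and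
        b.\<close>
      have swap: "s S a \<otimes> u = u \<otimes> s S a" using comm sA[OF S ab(1)] BA[OF u] by blast
      have lcomm: "x u b \<odot> (x u a \<odot> (u \<otimes> u)) = x u a \<odot> (x u b \<odot> (u \<otimes> u))"
        using xK[OF u ab(1)] xK[OF u ab(2)] prod_closed[OF BA[OF u] BA[OF u]]
        by (simp add: R.m_comm flip: smult_assoc1)
      show "s (insert u S) a \<otimes> s (insert u S) b
        = (x u a \<otimes>\<^bsub>K\<^esub> x u b) \<odot> (u \<otimes> u)
          \<oplus> ((x u a \<odot> (u \<otimes> s S b) \<oplus> x u b \<odot> (u \<otimes> s S a)) \<oplus> s S a \<otimes> s S b)"
        using ab u S insert.hyps
        by (simp add: s_insert BA xK sA prod_add_right prod_add_left prod_smult_right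
            prod_smult_left smult_assoc1 smult_r_distr prod_closed swap lcomm M.a_ac)
    qed auto
  qed
  from this[OF B(1) order_refl]
  have "diagonalizable (x ` B) (\<lambda>a b. a \<otimes> b)"
    by (rule diagonalizable_cong) (simp_all add: s_def flip: expand)
  moreover have "a = b" if "a \<in> carrier A" "b \<in> carrier A" "\<forall>f\<in>x ` B. f a = f b" for a b
  proof -
    have "s B a = s B b" unfolding s_def
      by (rule M.finsum_cong') (use that xK BA in auto)
    then show ?thesis using that by (simp add: s_def flip: expand)
  qed
  ultimately show thesis by (rule that)
qed

end

section \<open>The evolution algebra, the embedding and the lifted automorphisms\<close>

theorem theorem6p1:
  fixes K :: "('k, 'r) ring_scheme" and A :: "('k, 'a, 'm) module_scheme"
  assumes "nonassoc_algebra K A"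
    and "vectorspace.fin_dim K A"
    and "\<forall>x\<in>carrier A. \<forall>y\<in>carrier A. x \<otimes>\<^bsub>A\<^esub> y = y \<otimes>\<^bsub>A\<^esub> x"
    and "finite (carrier (AlgebraAut K A))"
  shows "\<exists>(E :: ('k, nat \<Rightarrow> 'k) module) \<psi> g.
    evolution_algebra K E \<and> vectorspace.fin_dim K E \<and>
    \<psi> \<in> algebra_hom K A E \<and> inj_on \<psi> (carrier A) \<and>
    g \<in> mon (AlgebraAut K A) (AlgebraAut K E) \<and>
    (\<forall>\<tau>\<in>carrier (AlgebraAut K A). \<forall>a\<in>carrier A. g \<tau> (\<psi> a) = \<psi> (\<tau> a))"
proof -
  interpret A: nonassoc_algebra K A by (rule assms(1))
  define G where "G = algebra_auto K A"
  have carrier_G: "carrier (AlgebraAut K A) = G" by (simp add: AlgebraAut_def G_def)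
  have mult_G: "\<sigma> \<otimes>\<^bsub>AlgebraAut K A\<^esub> \<tau> = compose (carrier A) \<sigma> \<tau>" if "\<sigma> \<in> G" "\<tau> \<in> G" for \<sigma> \<tau>
    using that by (simp add: AlgebraAut_def BijGroup_def G_def algebra_auto_def)
  interpret Aut: group "AlgebraAut K A" by (rule A.group_AlgebraAut)
  have G_comp: "compose (carrier A) \<sigma> \<tau> \<in> G" if "\<sigma> \<in> G" "\<tau> \<in> G" for \<sigma> \<tau>
    using Aut.m_closed[of \<sigma> \<tau>] that by (simp add: carrier_G mult_G)
  have G_bij: "bij_betw \<tau> (carrier A) (carrier A)" if "\<tau> \<in> G" for \<tau>
    using that by (simp add: G_def algebra_auto_def Bij_def)
  have G_closed: "\<tau> a \<in> carrier A" if "\<tau> \<in> G" "a \<in> carrier A" for \<tau> a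
    using bij_betw_imp_funcset[OF G_bij[OF that(1)]] that(2) by auto
  have G_add: "\<tau> (a \<oplus>\<^bsub>A\<^esub> b) = \<tau> a \<oplus>\<^bsub>A\<^esub> \<tau> b"
    and G_smult: "r \<in> carrier K \<Longrightarrow> \<tau> (r \<odot>\<^bsub>A\<^esub> a) = r \<odot>\<^bsub>A\<^esub> \<tau> a"
    and G_mult: "\<tau> (a \<otimes>\<^bsub>A\<^esub> b) = \<tau> a \<otimes>\<^bsub>A\<^esub> \<tau> b"
    if "\<tau> \<in> G" "a \<in> carrier A" "b \<in> carrier A" for \<tau> a b r
    using that by (auto simp: G_def algebra_auto_def algebra_hom_def module_hom_def hom_def)
  have G_ext: "\<sigma> = \<tau>" if "\<sigma> \<in> G" "\<tau> \<in> G" "\<And>a. a \<in> carrier A \<Longrightarrow> \<sigma> a = \<tau> a" for \<sigma> \<tau>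
    using that by (auto simp: G_def algebra_auto_def Bij_def intro: extensionalityI)

  obtain F where F: "A.diagonalizable F (\<lambda>a b. a \<otimes>\<^bsub>A\<^esub> b)"
    and F_sep: "\<And>a b. \<lbrakk>a \<in> carrier A; b \<in> carrier A; \<forall>f\<in>F. f a = f b\<rbrakk> \<Longrightarrow> a = b"
    using A.diagonalizable_product[OF assms(2,3)] by blast
  obtain n :: nat and L w where L: "\<And>i. i < n \<Longrightarrow> A.linear_functional (L i)"
    and w: "\<And>i. i < n \<Longrightarrow> w i \<in> carrier A" and FL: "F \<subseteq> L ` {..<n}"
    and product: "\<And>a b. \<lbrakk>a \<in> carrier A; b \<in> carrier A\<rbrakk>
      \<Longrightarrow> a \<otimes>\<^bsub>A\<^esub> b = (\<Oplus>\<^bsub>A\<^esub>i\<in>{..<n}. (L i a \<otimes>\<^bsub>K\<^esub> L i b) \<odot>\<^bsub>A\<^esub> w i)"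
    using F unfolding A.diagonalizable_def by blast
  note LK = A.linear_functional_closed[OF L]

  \<comment> \<open>The basis is indexed by pairs of an automorphism and a number below
    \<open>n\<close>. Finiteness of Aut(A) allows these pairs to be coded by natural numbers, the
    index type required: \<gamma> and \<pi> decode the two components and \<open>e\<close> is the
    coding.\<close>
  have "finite (G \<times> {..<n})" using assms(4) by (simp add: carrier_G)
  then obtain d :: "nat \<Rightarrow> ('a \<Rightarrow> 'a) \<times> nat" and N where d: "bij_betw d {0..<N} (G \<times> {..<n})"
    using ex_bij_betw_nat_finite by blast
  define J where "J = {0..<N}"
  define \<gamma> where "\<gamma> k = fst (d k)" for k
  define \<pi> where "\<pi> k = snd (d k)" for k
  note dJ = d[folded J_def]
  have \<gamma>: "\<gamma> k \<in> G" and \<pi>: "\<pi> k < n" if "k \<in> J" for k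
    using bij_betw_apply[OF dJ that] by (auto simp: \<gamma>_def \<pi>_def mem_Times_iff)
  define e where "e = inv_into J d"
  have e_J: "e (\<tau>, i) \<in> J" and \<gamma>_e: "\<gamma> (e (\<tau>, i)) = \<tau>" and \<pi>_e: "\<pi> (e (\<tau>, i)) = i"
    if "\<tau> \<in> G" "i < n" for \<tau> i
    using that bij_betw_apply[OF bij_betw_inv_into[OF dJ], of "(\<tau>, i)"]
      bij_betw_inv_into_right[OF dJ, of "(\<tau>, i)"]
    by (auto simp: e_def \<gamma>_def \<pi>_def)
  have e_d: "e (\<gamma> k, \<pi> k) = k" if "k \<in> J" for k
    using bij_betw_inv_into_left[OF dJ that] by (simp add: e_def \<gamma>_def \<pi>_def)

  \<comment> \<open>Block diagonal: the square of a basis vector stays in its own copy, and all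
    copies have the same constants L_j(w_i).\<close>
  define c where "c i k = (if \<gamma> i = \<gamma> k then L (\<pi> k) (w (\<pi> i)) else \<zero>\<^bsub>K\<^esub>)" for i k
  interpret S: structure_constants K J c
    by unfold_locales (auto simp: J_def[symmetric] c_def LK \<pi> w, simp add: J_def)
  let ?E = "evol_alg K J c"

  define \<psi> where "\<psi> a = (\<lambda>k\<in>J. L (\<pi> k) (\<gamma> k a))" for a
  have \<psi>_closed: "\<psi> a \<in> carrier ?E" if "a \<in> carrier A" for a
    using that by (auto simp: \<psi>_def S.carrier_E LK \<pi> \<gamma> G_closed)
  have \<psi>_apply: "\<psi> a k = L (\<pi> k) (\<gamma> k a)" if "k \<in> J" for a k
    using that by (simp add: \<psi>_def)
  have "\<psi> \<in> module_hom K A ?E"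
    unfolding module_hom_def
    by (auto intro!: S.E_eqI simp: \<psi>_closed S.add_E_closed S.smult_E_closed \<psi>_apply G_add G_smult
        A.linear_functional_add[OF L] A.linear_functional_smult[OF L] \<pi> \<gamma> G_closed)
  moreover have "\<psi> \<in> hom A ?E"
    unfolding hom_def
  proof (clarsimp simp: \<psi>_closed, rule S.E_eqI)
    fix a b k assume ab: "a \<in> carrier A" "b \<in> carrier A" and k: "k \<in> J"
    let ?h = "\<lambda>i. (L i (\<gamma> k a) \<otimes>\<^bsub>K\<^esub> L i (\<gamma> k b)) \<otimes>\<^bsub>K\<^esub> L (\<pi> k) (w i)"
    \<comment> \<open>The indices in the same copy as k; by the choice of \<open>c\<close> no others
      contribute to the product at k.\<close>
    let ?T = "(\<lambda>i. e (\<gamma> k, i)) ` {..<n}"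
    have \<gamma>k: "\<gamma> k a \<in> carrier A" "\<gamma> k b \<in> carrier A" using ab k by (simp_all add: \<gamma> G_closed)
    have inj: "inj_on (\<lambda>i. e (\<gamma> k, i)) {..<n}"
      by (rule inj_on_inverseI[of _ \<pi>]) (simp add: \<pi>_e \<gamma> k)
    have mem_T: "i \<in> ?T" if "i \<in> J" "\<gamma> i = \<gamma> k" for i
      using e_d[OF that(1)] \<pi>[OF that(1)] that(2) by (auto simp: image_iff intro!: bexI[of _ "\<pi> i"])
    have "(\<psi> a \<otimes>\<^bsub>?E\<^esub> \<psi> b) k = (\<Oplus>\<^bsub>K\<^esub>i\<in>J. (\<psi> a i \<otimes>\<^bsub>K\<^esub> \<psi> b i) \<otimes>\<^bsub>K\<^esub> c i k)"
      using k by (rule S.mult_E)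
    also have "\<dots> = (\<Oplus>\<^bsub>K\<^esub>i\<in>?T. (\<psi> a i \<otimes>\<^bsub>K\<^esub> \<psi> b i) \<otimes>\<^bsub>K\<^esub> c i k)"
    proof (rule A.R.add.finprod_mono_neutral_cong_right)
      show "?T \<subseteq> J" using k by (auto simp: e_J \<gamma>)
      show "(\<psi> a i \<otimes>\<^bsub>K\<^esub> \<psi> b i) \<otimes>\<^bsub>K\<^esub> c i k = \<zero>\<^bsub>K\<^esub>" if "i \<in> J - ?T" for i
        using that mem_T[of i] ab by (auto simp: c_def \<psi>_closed)
    qed (use ab k S.finite_J in \<open>auto simp: \<psi>_closed S.c_closed\<close>)
    also have "\<dots> = (\<Oplus>\<^bsub>K\<^esub>i\<in>{..<n}. (\<psi> a (e (\<gamma> k, i)) \<otimes>\<^bsub>K\<^esub> \<psi> b (e (\<gamma> k, i))) \<otimes>\<^bsub>K\<^esub> c (e (\<gamma> k, i)) k)"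
      by (rule A.R.finsum_reindex[OF _ inj]) (use ab k in \<open>auto simp: \<psi>_closed S.c_closed e_J \<gamma>\<close>)
    also have "\<dots> = (\<Oplus>\<^bsub>K\<^esub>i\<in>{..<n}. ?h i)"
      by (rule A.R.finsum_cong')
        (use ab k \<gamma>k in \<open>auto simp: \<psi>_apply c_def e_J \<gamma>_e \<pi>_e \<gamma> \<pi> LK w\<close>)
    \<comment> \<open>Linearity moves the scalars and then the sum inside the functional, where the
      diagonal form of the product reappears, evaluated at the images of a and b under
      \<gamma>(k).\<close>
    also have "\<dots> = (\<Oplus>\<^bsub>K\<^esub>i\<in>{..<n}. L (\<pi> k) ((L i (\<gamma> k a) \<otimes>\<^bsub>K\<^esub> L i (\<gamma> k b)) \<odot>\<^bsub>A\<^esub> w i))"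
      by (rule A.R.finsum_cong')
        (use \<gamma>k k in \<open>auto simp: A.linear_functional_smult[OF L] \<pi> LK w\<close>)
    also have "\<dots> = L (\<pi> k) (\<gamma> k a \<otimes>\<^bsub>A\<^esub> \<gamma> k b)"
      unfolding product[OF \<gamma>k]
      by (rule A.linear_functional_finsum[OF L, symmetric]) (use \<gamma>k k in \<open>auto simp: \<pi> LK w\<close>)
    also have "\<dots> = \<psi> (a \<otimes>\<^bsub>A\<^esub> b) k"
      using ab k by (simp add: \<psi>_apply G_mult \<gamma>)
    finally show "\<psi> (a \<otimes>\<^bsub>A\<^esub> b) k = (\<psi> a \<otimes>\<^bsub>?E\<^esub> \<psi> b) k" ..
  qed (simp_all add: \<psi>_closed S.mult_E_closed A.prod_closed)
  ultimately have \<psi>_hom: "\<psi> \<in> algebra_hom K A ?E" by (simp add: algebra_hom_def)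

  have id_G: "(\<lambda>a\<in>carrier A. a) \<in> G"
    using Aut.one_closed by (simp add: AlgebraAut_def BijGroup_def G_def)
  have \<psi>_inj: "inj_on \<psi> (carrier A)"
  proof (rule inj_onI)
    fix a b assume ab: "a \<in> carrier A" "b \<in> carrier A" "\<psi> a = \<psi> b"
    have "L i a = L i b" if "i < n" for i
    proof -
      \<comment> \<open>The copy of the identity automorphism records all L_i(a), and the L_i
        include the separating set \<open>F\<close>.\<close>
      define k where "k = e (\<lambda>a\<in>carrier A. a, i)"
      have k: "k \<in> J" "\<gamma> k = (\<lambda>a\<in>carrier A. a)" "\<pi> k = i"
        using that id_G by (simp_all add: k_def e_J \<gamma>_e \<pi>_e)
      have "L (\<pi> k) (\<gamma> k a) = L (\<pi> k) (\<gamma> k b)" using ab(3) k(1) by (metis \<psi>_apply)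
      then show ?thesis using ab by (simp add: k)
    qed
    then show "a = b" using ab FL by (intro F_sep) auto
  qed

  \<comment> \<open>Copy \<sigma> goes to copy \<sigma> \<circ> \<tau>, since
    L_i(\<sigma>(\<tau>(a))) is the coordinate of \<psi>(a) at (\<sigma> \<circ> \<tau>, i). This is
    a right action of Aut(A) on the indices.\<close>
  define \<rho> where "\<rho> \<tau> k = e (compose (carrier A) (\<gamma> k) \<tau>, \<pi> k)" for \<tau> k
  have \<rho>_J: "\<rho> \<tau> k \<in> J" and \<gamma>_\<rho>: "\<gamma> (\<rho> \<tau> k) = compose (carrier A) (\<gamma> k) \<tau>"
    and \<pi>_\<rho>: "\<pi> (\<rho> \<tau> k) = \<pi> k" if "\<tau> \<in> G" "k \<in> J" for \<tau> k
    using that by (simp_all add: \<rho>_def e_J \<gamma>_e \<pi>_e \<gamma> \<pi> G_comp)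
  \<comment> \<open>Right cancellation in Aut(A) serves twice: it makes the action on indices
    injective, and it keeps distinct copies distinct, so that the structure constants are
    invariant.\<close>
  have cancel: "\<gamma> i = \<gamma> k" if "\<tau> \<in> G" "i \<in> J" "k \<in> J"
    "compose (carrier A) (\<gamma> i) \<tau> = compose (carrier A) (\<gamma> k) \<tau>" for \<tau> i k
    using that Aut.right_cancel[of \<tau> "\<gamma> i" "\<gamma> k"] by (simp add: carrier_G mult_G \<gamma>)
  have \<rho>_bij: "bij_betw (\<rho> \<tau>) J J" if \<tau>: "\<tau> \<in> G" for \<tau>
  proof -
    have "inj_on (\<rho> \<tau>) J"
    proof (rule inj_onI)
      fix i k assume ik: "i \<in> J" "k \<in> J" "\<rho> \<tau> i = \<rho> \<tau> k"
      have "\<gamma> i = \<gamma> k" using \<gamma>_\<rho>[OF \<tau>] ik by (intro cancel[OF \<tau>]) metis+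
      moreover have "\<pi> i = \<pi> k" using \<pi>_\<rho>[OF \<tau>] ik by metis
      ultimately show "i = k" using e_d ik by metis
    qed
    then show ?thesis
      using \<rho>_J[OF \<tau>] S.finite_J by (simp add: bij_betw_def endo_inj_surj image_subset_iff)
  qed
  have c_\<rho>: "c (\<rho> \<tau> i) (\<rho> \<tau> k) = c i k" if "\<tau> \<in> G" "i \<in> J" "k \<in> J" for \<tau> i k
    using that cancel[OF that] by (auto simp: c_def \<gamma>_\<rho> \<pi>_\<rho>)
  have \<rho>_compose: "\<rho> (compose (carrier A) \<sigma> \<tau>) k = \<rho> \<tau> (\<rho> \<sigma> k)"
    if "\<sigma> \<in> G" "\<tau> \<in> G" "k \<in> J" for \<sigma> \<tau> k
  proof -
    have "compose (carrier A) (\<gamma> k) (compose (carrier A) \<sigma> \<tau>)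
        = compose (carrier A) (compose (carrier A) (\<gamma> k) \<sigma>) \<tau>"
      using that by (auto simp: compose_def G_closed)
    then show ?thesis
      unfolding \<rho>_def[of "compose (carrier A) \<sigma> \<tau>"] \<rho>_def[of \<tau>] using that by (simp add: \<gamma>_\<rho> \<pi>_\<rho>)
  qed

  define g where "g \<tau> = S.permute (\<rho> \<tau>)" for \<tau>
  have g_auto: "g \<tau> \<in> algebra_auto K ?E" if "\<tau> \<in> G" for \<tau>
    unfolding g_def using that by (intro S.permute_algebra_auto \<rho>_bij c_\<rho>)
  have equivariant: "g \<tau> (\<psi> a) = \<psi> (\<tau> a)" if \<tau>: "\<tau> \<in> G" and a: "a \<in> carrier A" for \<tau> a
  proof (rule S.E_eqI)
    show "g \<tau> (\<psi> a) \<in> carrier ?E"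
      unfolding g_def using \<rho>_J[OF \<tau>] \<psi>_closed[OF a] by (intro S.permute_closed) auto
    fix k assume "k \<in> J"
    \<comment> \<open>At the index (\<sigma>, i) both sides are L_i(\<sigma>(\<tau>(a))).\<close>
    then show "g \<tau> (\<psi> a) k = \<psi> (\<tau> a) k"
      using \<tau> a by (simp add: g_def \<psi>_closed \<psi>_apply \<rho>_J \<gamma>_\<rho> \<pi>_\<rho> compose_def)
  qed (simp add: \<psi>_closed G_closed a \<tau>)
  have "g \<in> hom (AlgebraAut K A) (AlgebraAut K ?E)"
  proof (rule homI)
    fix \<sigma> \<tau> assume "\<sigma> \<in> carrier (AlgebraAut K A)" "\<tau> \<in> carrier (AlgebraAut K A)"
    then have \<sigma>\<tau>: "\<sigma> \<in> G" "\<tau> \<in> G" by (simp_all add: carrier_G)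
    have "g (compose (carrier A) \<sigma> \<tau>) = compose (carrier ?E) (g \<sigma>) (g \<tau>)"
    proof (rule extensionalityI[where A = "carrier ?E"])
      fix x assume x: "x \<in> carrier ?E"
      have cl: "g \<upsilon> y \<in> carrier ?E" if "\<upsilon> \<in> G" "y \<in> carrier ?E" for \<upsilon> y
        unfolding g_def using \<rho>_J[OF that(1)] that(2) by (intro S.permute_closed) auto
      show "g (compose (carrier A) \<sigma> \<tau>) x = compose (carrier ?E) (g \<sigma>) (g \<tau>) x"
      proof (rule S.E_eqI)
        fix k assume k: "k \<in> J"
        \<comment> \<open>The right action and the precomposition in \<open>permute\<close> each
          reverse the order, so together they preserve it.\<close>
        have "g \<sigma> (g \<tau> x) k = g \<tau> x (\<rho> \<sigma> k)"
          using cl[OF \<sigma>\<tau>(2) x] k by (simp add: g_def)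
        also have "\<dots> = x (\<rho> \<tau> (\<rho> \<sigma> k))" using x k \<sigma>\<tau> by (simp add: g_def \<rho>_J)
        finally show "g (compose (carrier A) \<sigma> \<tau>) x k = compose (carrier ?E) (g \<sigma>) (g \<tau>) x k"
          using x k \<sigma>\<tau> by (simp add: g_def[of "compose (carrier A) \<sigma> \<tau>"] compose_eq \<rho>_compose)
      qed (use x \<sigma>\<tau> in \<open>simp_all add: compose_eq cl G_comp\<close>)
    qed (simp_all add: g_def S.permute_def)
    then show "g (\<sigma> \<otimes>\<^bsub>AlgebraAut K A\<^esub> \<tau>) = g \<sigma> \<otimes>\<^bsub>AlgebraAut K ?E\<^esub> g \<tau>"
      using g_auto[OF \<sigma>\<tau>(1)] g_auto[OF \<sigma>\<tau>(2)]
      by (simp add: mult_G \<sigma>\<tau>) (simp add: AlgebraAut_def BijGroup_def algebra_auto_def)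
  next
    fix \<tau> assume "\<tau> \<in> carrier (AlgebraAut K A)"
    then show "g \<tau> \<in> carrier (AlgebraAut K ?E)"
      using g_auto by (simp add: carrier_G) (simp add: AlgebraAut_def)
  qed
  moreover have "inj_on g (carrier (AlgebraAut K A))"
  proof (rule inj_onI)
    fix \<sigma> \<tau> assume "\<sigma> \<in> carrier (AlgebraAut K A)" "\<tau> \<in> carrier (AlgebraAut K A)" and eq: "g \<sigma> = g \<tau>"
    then have \<sigma>\<tau>: "\<sigma> \<in> G" "\<tau> \<in> G" by (simp_all add: carrier_G)
    show "\<sigma> = \<tau>"
    proof (rule G_ext[OF \<sigma>\<tau>])
      fix a assume a: "a \<in> carrier A"
      \<comment> \<open>The lift determines the automorphism through its effect on the embedded copy
        of A.\<close>
      have "\<psi> (\<sigma> a) = \<psi> (\<tau> a)"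
        using equivariant[OF \<sigma>\<tau>(1) a] equivariant[OF \<sigma>\<tau>(2) a] eq by simp
      then show "\<sigma> a = \<tau> a"
        using \<psi>_inj a \<sigma>\<tau> by (auto dest: inj_onD simp: G_closed)
    qed
  qed
  ultimately have "g \<in> mon (AlgebraAut K A) (AlgebraAut K ?E)" by (simp add: mon_def)
  then show ?thesis
    using S.evolution_algebra_E S.fin_dim_E \<psi>_hom \<psi>_inj equivariant carrier_G by blast
qed

end
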